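(* Let $m\in\mathbb{Z}_{+}=\{0,1,2,\dots\}$ and $0<q<1$. Then for each fixed $z\in\mathbb{C}_{q,m}$ and every $\xi\in\mathcal{I}_q$, the wave function of the coherent state $|z,m,q\rangle$, that is, $\langle \xi|z,m,q\rangle=(\mathcal{N}_{m,q}(z\bar z))^{-1/2}\sum_{j\ge 0}\overline{h_j^{m,q}(z)}\,\varphi_j^q(\xi)$, is given by $$\langle \xi|z,m,q\rangle=(-1)^m\left(\frac{\sqrt{2}\,\omega_q(\sqrt{2}\,\xi)}{q^m(q;q)_m\,\mathcal{N}_{m,q}(z\bar z)}\right)^{1/2}\frac{Q_m\!\left(\sqrt{\tfrac{1-q}{2}}\,\xi;\ \sqrt{\tfrac{1-q}{q^m}}\,\bar z,\ \sqrt{\tfrac{1-q}{q^m}}\,q z\,\Big|\,q\right)}{\left(\sqrt{\tfrac{1-q}{q^m}}\,\bar z e^{i\theta_\xi};q\right)_\infty\left(\sqrt{\tfrac{1-q}{q^m}}\,\bar z e^{-i\theta_\xi};q\right)_\infty},$$ where $\theta_\xi=\arccos\!\left(\xi\sqrt{\tfrac{1-q}{2}}\right)$.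
   Context: Notation: $(a;q)_n=\prod_{k=0}^{n-1}(1-aq^k)$ for $n\in\{0,1,\dots\}\cup\{\infty\}$; $m\wedge j=\min(m,j)$, $m\vee j=\max(m,j)$. Basic hypergeometric series: $(a_1,\dots,a_r;q)_k=\prod_i(a_i;q)_k$, ${}_2\phi_1(a,b;c\,|\,q;x)=\sum_{k\ge0}\frac{(a,b;q)_k}{(c,q;q)_k}x^k$ and ${}_3\phi_2(a,b,c;d,e\,|\,q;x)=\sum_{k\ge0}\frac{(a,b,c;q)_k}{(d,e,q;q)_k}x^k$. Wall polynomials: $P_n(x;a|q)={}_2\phi_1(q^{-n},0;aq\,|\,q;qx)$. Coefficients: for $m,j\in\mathbb{Z}_+$ and $z\in\mathbb{C}$ with $\theta=\arg z$, $$h_j^{m,q}(z)=\frac{(-1)^{m\wedge j}(q;q)_{m\vee j}\,q^{\binom{m\wedge j}{2}}(\sqrt{1-q})^{|m-j|}|z|^{|m-j|}e^{-i(m-j)\theta}}{(q;q)_{|m-j|}\sqrt{q^{mj}(q;q)_m(q;q)_j}}\,P_{m\wedge j}\big((1-q)z\bar z;q^{|m-j|}\big|q\big).$$ Continuous $q$-Hermite polynomials: $H_n(\cos\theta|q)=\sum_{k=0}^n\frac{(q;q)_n}{(q;q)_k(q;q)_{n-k}}e^{i(n-2k)\theta}$. Weight: $\omega_q(u)=\dfrac{(q;q)_\infty\sqrt{1-q}}{4\pi\sqrt{1-(1-q)u^2/4}}\prod_{k\ge0}\big(1+(2-u^2(1-q))q^k+q^{2k}\big)$. Interval: $\mathcal{I}_q=\left(-\frac{\sqrt2}{\sqrt{1-q}},\frac{\sqrt2}{\sqrt{1-q}}\right)$.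 The functions $\varphi_j^q(\xi)=\sqrt{\frac{\sqrt2\,\omega_q(\sqrt2\,\xi)}{(q;q)_j}}\,H_j\!\left(\sqrt{\tfrac{1-q}{2}}\,\xi\,\big|\,q\right)$, $j\ge0$, are orthonormal in $L^2(\mathcal{I}_q,d\xi)$. Domain: $\mathbb{C}_{q,m}=\{z\in\mathbb{C}:(1-q)z\bar z<q^m\}$. Normalization factor: $\mathcal{N}_{m,q}(z\bar z)=\dfrac{q^{-m}(q^{1-m}(1-q)z\bar z;q)_m}{(q^{-m}(1-q)z\bar z;q)_\infty}$. Coherent state: $|z,m,q\rangle=(\mathcal{N}_{m,q}(z\bar z))^{-1/2}\sum_{j\ge0}\overline{h_j^{m,q}(z)}\,|\varphi_j^q\rangle$. Al-Salam–Chihara polynomials: for $x=\cos\theta$, $Q_m(x;a,b|q)=\dfrac{(ab;q)_m}{a^m}\,{}_3\phi_2\big(q^{-m},ae^{i\theta},ae^{-i\theta};ab,0\,\big|\,q;q\big)$; this is a polynomial in $x,a,b$, and for $a=0$ it is understood by continuity. *)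

theory Defs
  imports "HOL-Analysis.Analysis"
begin

definition qpoch :: "'a::comm_ring_1 \<Rightarrow> 'a \<Rightarrow> nat \<Rightarrow> 'a" where
  "qpoch a q n = (\<Prod>k<n. 1 - a * q ^ k)"

definition qpoch_inf :: "'a::real_normed_field \<Rightarrow> 'a \<Rightarrow> 'a" where
  "qpoch_inf a q = (\<Prod>k. 1 - a * q ^ k)"

definition phi21 :: "'a::real_normed_field \<Rightarrow> 'a \<Rightarrow> 'a \<Rightarrow> 'a \<Rightarrow> 'a \<Rightarrow> 'a" where
  "phi21 a b c q x =
     (\<Sum>k. qpoch a q k * qpoch b q k / (qpoch c q k * qpoch q q k) * x ^ k)"

definition phi32 ::
  "'a::real_normed_field \<Rightarrow> 'a \<Rightarrow> 'a \<Rightarrow> 'a \<Rightarrow> 'a \<Rightarrow> 'a \<Rightarrow> 'a \<Rightarrow> 'a" where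
  "phi32 a b c d e q x =
     (\<Sum>k. qpoch a q k * qpoch b q k * qpoch c q k /
            (qpoch d q k * qpoch e q k * qpoch q q k) * x ^ k)"

definition wall_poly :: "nat \<Rightarrow> real \<Rightarrow> real \<Rightarrow> real \<Rightarrow> real" where
  "wall_poly n x a q = phi21 (q powi (- int n)) 0 (a * q) q (q * x)"

definition coeff_h :: "nat \<Rightarrow> real \<Rightarrow> nat \<Rightarrow> complex \<Rightarrow> complex" where
  "coeff_h m q j z =
     (let d = nat \<bar>int m - int j\<bar> in
        of_real ((-1) ^ min m j * qpoch q q (max m j) * q ^ (min m j choose 2)
                   * sqrt (1 - q) ^ d * cmod z ^ d)
        * cis (- (real m - real j) * Arg z)
        / of_real (qpoch q q d * sqrt (q ^ (m * j) * qpoch q q m * qpoch q q j))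
        * of_real (wall_poly (min m j) ((1 - q) * (cmod z)\<^sup>2) (q ^ d) q))"

text \<open>Polynomials in \<open>x = cos \<theta>\<close> are evaluated at \<open>\<theta> = Arccos x\<close>; the complex arc cosine
  satisfies \<open>cos (Arccos x) = x\<close> for every \<open>x\<close>, and agrees with the real one on \<open>[-1, 1]\<close>.\<close>

definition q_hermite :: "nat \<Rightarrow> complex \<Rightarrow> complex \<Rightarrow> complex" where
  "q_hermite n x q =
     (\<Sum>k\<le>n. qpoch q q n / (qpoch q q k * qpoch q q (n - k))
               * exp (\<i> * of_int (int n - 2 * int k) * Arccos x))"

definition weight :: "real \<Rightarrow> real \<Rightarrow> real" where
  "weight q u =
     qpoch_inf q q * sqrt (1 - q) / (4 * pi * sqrt (1 - (1 - q) * u\<^sup>2 / 4))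
       * (\<Prod>k. 1 + (2 - u\<^sup>2 * (1 - q)) * q ^ k + q ^ (2 * k))"

definition interval_I :: "real \<Rightarrow> real set" where
  "interval_I q = {- (sqrt 2 / sqrt (1 - q)) <..< sqrt 2 / sqrt (1 - q)}"

definition phi_fun :: "real \<Rightarrow> nat \<Rightarrow> real \<Rightarrow> complex" where
  "phi_fun q j \<xi> =
     of_real (sqrt (sqrt 2 * weight q (sqrt 2 * \<xi>) / qpoch q q j))
       * q_hermite j (of_real (sqrt ((1 - q) / 2) * \<xi>)) (of_real q)"

definition domain_C :: "real \<Rightarrow> nat \<Rightarrow> complex set" where
  "domain_C q m = {z. (1 - q) * (cmod z)\<^sup>2 < q ^ m}"

text \<open>The argument \<open>t\<close> stands for \<open>z * cnj z\<close>, that is \<open>(cmod z)\<^sup>2\<close>.\<close>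

definition norm_factor :: "nat \<Rightarrow> real \<Rightarrow> real \<Rightarrow> real" where
  "norm_factor m q t =
     q powi (- int m) * qpoch (q powi (1 - int m) * (1 - q) * t) q m
       / qpoch_inf (q powi (- int m) * (1 - q) * t) q"

definition wave_function :: "nat \<Rightarrow> real \<Rightarrow> complex \<Rightarrow> real \<Rightarrow> complex" where
  "wave_function m q z \<xi> =
     complex_of_real ((norm_factor m q ((cmod z)\<^sup>2)) powr (- (1/2)))
       * (\<Sum>j. cnj (coeff_h m q j z) * phi_fun q j \<xi>)"

definition asc_formula ::
  "nat \<Rightarrow> complex \<Rightarrow> complex \<Rightarrow> complex \<Rightarrow> complex \<Rightarrow> complex" where
  "asc_formula m x a b q =
     qpoch (a * b) q m / a ^ m
       * phi32 (q powi (- int m)) (a * exp (\<i> * Arccos x)) (a * exp (- \<i> * Arccos x))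
           (a * b) 0 q q"

text \<open>As a function of \<open>a\<close>, the formula has removable singularities at \<open>a = 0\<close> and where
  \<open>(ab; q)\<^sub>m = 0\<close>; there the value is taken by continuity.\<close>

definition al_salam_chihara ::
  "nat \<Rightarrow> complex \<Rightarrow> complex \<Rightarrow> complex \<Rightarrow> complex \<Rightarrow> complex" where
  "al_salam_chihara m x a b q =
     (if a \<noteq> 0 \<and> qpoch (a * b) q m \<noteq> 0 then asc_formula m x a b q
      else Lim (at a) (\<lambda>a'. asc_formula m x a' b q))"

end

theory Submission
  imports Defs
begin

text \<open>
  Put \<open>a = c \<cdot> cnj z\<close> and \<open>b = c q z\<close>, where \<open>c = sqrt ((1 - q) / q^m)\<close>. The domain of \<open>z\<close> is the
  disc \<open>\<bar>a\<bar> < 1\<close>, and \<open>ab = q \<bar>a\<bar>\<^sup>2\<close>. The cases \<open>j < m\<close> and \<open>j \<ge> m\<close> of the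
  coefficients look different only because the Wall polynomial is attached to \<open>min m j\<close>: once its
  finite sum is written out and reversed, both become, up to a normalisation, the same expression
  (\<open>asc_coeff\<close>)
  \[ \sum_{p \le \min(m,j)} (-1)^{m-p} q^{\binom{m-p}{2}}
       \frac{(q;q)_m}{(q;q)_{m-p}\,(q;q)_p} \, \frac{b^{m-p} a^{j-p}}{(q;q)_{j-p}} \]
  (\<open>cnj_coeff_h\<close>). So the wave function is the sum of this expression times \<open>H_j(cos \<theta>)\<close>.

  For \<open>a \<noteq> 0\<close>, Rothe's finite \<open>q\<close>-binomial identity, applied twice, turns the same expression into
  \[ a^{-m} \sum_{k \le m} \frac{(q^{-m};q)_k\, q^k}{(q;q)_k}\, (abq^k;q)_{m-k}\,
       \frac{(a q^k)^j}{(q;q)_j} \]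
  (\<open>q_difference_monomial_shifted\<close>), in which \<open>j\<close> occurs only as in the generating function
  \<open>\<Sum>j. t^j H_j / (q;q)_j = 1 / ((t e^{i\<theta>};q)_\<infinity> (t e^{-i\<theta>};q)_\<infinity>)\<close>, at the points
  \<open>t = a q^k\<close>. Summing over \<open>j\<close> first thus gives convergence and value together. Moreover
  \<open>(x q^k;q)_\<infinity> = (x;q)_\<infinity> / (x;q)_k\<close> moves the dependence on \<open>k\<close> into the factors
  \<open>(a e^{i\<theta>};q)_k (a e^{-i\<theta>};q)_k\<close>, and what remains is exactly the terminating basic hypergeometric
  series of the Al-Salam--Chihara polynomial (\<open>asc_generating_function\<close>).

  For \<open>z = 0\<close> only the term \<open>j = m\<close> survives, and the polynomial is a limit at \<open>a = 0\<close>. By the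
  result for \<open>b = 0\<close> it is, near \<open>0\<close>, a quotient of two power series in \<open>a\<close>, whence the limit
  \<open>H_m\<close> (\<open>asc_formula_tendsto_0\<close>).
\<close>

section \<open>Finite \<open>q\<close>-Pochhammer symbols\<close>

lemma qpoch_0 [simp]: "qpoch a q 0 = 1"
  by (simp add: qpoch_def)

lemma qpoch_Suc: "qpoch a q (Suc n) = qpoch a q n * (1 - a * q ^ n)"
  by (simp add: qpoch_def)

lemma qpoch_zero_left [simp]: "qpoch 0 q n = 1"
  by (simp add: qpoch_def)

lemma qpoch_add: "qpoch a q (m + n) = qpoch a q m * qpoch (a * q ^ m) q n"
  by (induction n) (simp_all add: qpoch_Suc power_add mult_ac)

lemma qpoch_of_real:
  "qpoch (of_real a) (of_real q) n = (of_real (qpoch a q n) :: 'a :: {real_normed_field})"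
  by (simp add: qpoch_def)

lemma norm_mult_power_less_1:
  fixes x q :: "'a :: real_normed_div_algebra"
  assumes "norm x < 1" "norm q < 1"
  shows "norm (x * q ^ k) < 1"
proof -
  have "norm (x * q ^ k) \<le> norm x * 1"
    unfolding norm_mult norm_power using assms by (intro mult_left_mono power_le_one) auto
  then show ?thesis using assms by simp
qed

lemma qpoch_nonzero:
  fixes a q :: "'a :: real_normed_field"
  assumes "norm a < 1" "norm q < 1"
  shows "qpoch a q n \<noteq> 0"
proof -
  have "1 - a * q ^ k \<noteq> 0" for k
    using norm_mult_power_less_1[OF assms, of k] by (metis eq_iff_diff_eq_0 less_irrefl norm_one)
  then show ?thesis by (simp add: qpoch_def)
qed

lemma power_choose_two_Suc: "q ^ (Suc n choose 2) = q ^ (n choose 2) * (q :: 'a :: monoid_mult) ^ n"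
  by (simp add: numeral_2_eq_2 add.commute[of n] power_add flip: power_add)

lemma qpoch_inverse_power_eq_0:
  fixes q :: "'a :: field"
  assumes "q \<noteq> 0" "n < k"
  shows "qpoch (q powi (- int n)) q k = 0"
  using assms by (auto simp: qpoch_def power_int_minus intro!: bexI[of _ n])

lemma qpoch_inverse_power:
  fixes q :: "'a :: field"
  assumes "q \<noteq> 0" and nz: "\<And>k. qpoch q q k \<noteq> 0" and "k \<le> n"
  shows "qpoch (q powi (- int n)) q k =
    (-1) ^ k * q ^ (k choose 2) * qpoch q q n / (qpoch q q (n - k) * q ^ (n * k))"
  using \<open>k \<le> n\<close>
proof (induction k)
  case (Suc k)
  then obtain r where n: "n = Suc (k + r)"
    by (metis Suc_le_eq less_natE)
  have nk: "n - k = Suc r" "n - Suc k = r" using n by auto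
  have pn: "q ^ n = q ^ k * q ^ Suc r" using n by (simp add: power_add)
  have last: "1 - q powi (- int n) * q ^ k = - (1 - q ^ Suc r) / q ^ Suc r"
    using \<open>q \<noteq> 0\<close> by (simp add: power_int_minus pn field_simps del: power_Suc)
  have "1 - q ^ Suc r \<noteq> 0"
    using nz[of "Suc r"] by (auto simp: qpoch_Suc)
  moreover have "q ^ (n * Suc k) = q ^ (n * k) * q ^ k * q ^ Suc r"
    using pn by (simp add: power_add mult_ac)
  ultimately show ?case
    using Suc nz[of r] \<open>q \<noteq> 0\<close>
    unfolding qpoch_Suc last power_choose_two_Suc nk
    by (simp add: qpoch_Suc field_simps del: power_Suc) (simp add: field_simps)
qed (use nz in \<open>simp add: binomial_eq_0\<close>)

section \<open>Rothe's identity and \<open>q\<close>-differences of monomials\<close>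

text \<open>The Gaussian binomial coefficient with the sign and the power of \<open>q\<close> that it carries in the
  expansion of \<open>(x;q)_n\<close>. It has its combinatorial meaning only for \<open>l \<le> n\<close>, as \<open>n - l\<close> is a
  truncated difference.\<close>
definition rothe_coeff :: "'a :: field \<Rightarrow> nat \<Rightarrow> nat \<Rightarrow> 'a" where
  "rothe_coeff q n l = (-1) ^ l * q ^ (l choose 2) * qpoch q q n / (qpoch q q l * qpoch q q (n - l))"

lemma rothe_coeff_0:
  assumes "\<And>k. qpoch q q k \<noteq> 0"
  shows "rothe_coeff q n 0 = 1"
  using assms by (simp add: rothe_coeff_def binomial_eq_0)

text \<open>The \<open>q\<close>-Pascal rule in the form that reflects multiplication of \<open>(x;q)_n\<close> by its next factor
  \<open>1 - x q^n\<close>.\<close>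
lemma rothe_coeff_Suc_Suc:
  fixes q :: "'a :: field"
  assumes nz: "\<And>k. qpoch q q k \<noteq> 0" and "l < n"
  shows "rothe_coeff q (Suc n) (Suc l) = rothe_coeff q n (Suc l) - q ^ n * rothe_coeff q n l"
proof -
  obtain r where n: "n = Suc (l + r)" using \<open>l < n\<close> by (metis less_natE)
  have nz': "1 - q ^ Suc k \<noteq> 0" for k using nz[of "Suc k"] by (auto simp: qpoch_Suc)
  have d: "Suc n - Suc l = Suc r" "n - Suc l = r" "n - l = Suc r" using n by auto
  have e: "q ^ Suc n = q ^ Suc l * q ^ Suc r" "q ^ n = q ^ l * q ^ Suc r"
    using n by (simp_all add: power_add)
  show ?thesis
    using nz[of n] nz[of l] nz[of r] nz'[of r] nz'[of l]
    unfolding rothe_coeff_def d qpoch_Suc power_choose_two_Suc power_Suc[symmetric] e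
    by (simp add: divide_simps del: power_Suc) (simp add: algebra_simps)
qed

theorem rothe_identity:
  fixes q x :: "'a :: field"
  assumes nz: "\<And>k. qpoch q q k \<noteq> 0"
  shows "(\<Sum>l\<le>n. rothe_coeff q n l * x ^ l) = qpoch x q n"
proof (induction n)
  case (Suc n)
  let ?c = "rothe_coeff q"
  \<comment> \<open>The \<open>q\<close>-Pascal rule does not cover the leading coefficient.\<close>
  have top: "?c (Suc n) (Suc n) = - (q ^ n * ?c n n)"
    using nz by (simp add: rothe_coeff_def power_choose_two_Suc)
  have "(\<Sum>l\<le>Suc n. ?c (Suc n) l * x ^ l)
      = 1 + (\<Sum>l<n. ?c (Suc n) (Suc l) * x ^ Suc l) + ?c (Suc n) (Suc n) * x ^ Suc n"
    using nz by (subst sum.atMost_Suc_shift) (simp add: rothe_coeff_0 lessThan_Suc_atMost[symmetric])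
  also have "(\<Sum>l<n. ?c (Suc n) (Suc l) * x ^ Suc l)
      = (\<Sum>l<n. ?c n (Suc l) * x ^ Suc l) - x * q ^ n * (\<Sum>l<n. ?c n l * x ^ l)"
    by (simp add: rothe_coeff_Suc_Suc nz algebra_simps sum_subtractf sum_distrib_left)
  also have "1 + \<dots> + ?c (Suc n) (Suc n) * x ^ Suc n
      = (1 + (\<Sum>l<n. ?c n (Suc l) * x ^ Suc l))
        - x * q ^ n * ((\<Sum>l<n. ?c n l * x ^ l) + ?c n n * x ^ n)"
    by (simp add: top algebra_simps)
  also have "1 + (\<Sum>l<n. ?c n (Suc l) * x ^ Suc l) = (\<Sum>l\<le>n. ?c n l * x ^ l)"
    using nz by (simp add: sum.atMost_shift rothe_coeff_0)
  also have "(\<Sum>l<n. ?c n l * x ^ l) + ?c n n * x ^ n = (\<Sum>l\<le>n. ?c n l * x ^ l)"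
    by (simp add: lessThan_Suc_atMost[symmetric])
  finally show ?case
    by (simp only: Suc.IH qpoch_Suc) (simp add: algebra_simps)
qed (simp add: rothe_coeff_def binomial_eq_0)

text \<open>The sum over \<open>k\<close> is the value at \<open>x = 1\<close> of the \<open>n\<close>-fold iterate of
  \<open>f(x) \<mapsto> (f(x) - f(qx)) / x\<close> on the monomial \<open>x^i\<close>. Each iteration takes \<open>x^r\<close> to
  \<open>(1 - q^r) x^(r-1)\<close>, which explains the result. The proof reads the sum as Rothe's expansion at
  \<open>x = q^(i + 1 - n)\<close>, where \<open>(x;q)_n\<close> has the factor \<open>1 - q^0\<close> if \<open>i < n\<close>.\<close>
lemma q_difference_monomial:
  fixes q :: "'a :: field"
  assumes "q \<noteq> 0" and nz: "\<And>k. qpoch q q k \<noteq> 0"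
  shows "(\<Sum>k\<le>n. qpoch (q powi (- int n)) q k * q ^ k / qpoch q q k * (q ^ k) ^ i)
     = (if n \<le> i then qpoch q q i / qpoch q q (i - n) else 0)"
proof -
  have "(\<Sum>k\<le>n. qpoch (q powi (- int n)) q k * q ^ k / qpoch q q k * (q ^ k) ^ i)
      = (\<Sum>k\<le>n. rothe_coeff q n k * (q * q ^ i / q ^ n) ^ k)"
    using assms
    by (intro sum.cong refl)
       (simp add: qpoch_inverse_power rothe_coeff_def power_mult_distrib power_divide
          field_simps flip: power_mult)
  also have "\<dots> = qpoch (q * q ^ i / q ^ n) q n"
    by (rule rothe_identity[OF nz])
  also have "\<dots> = (if n \<le> i then qpoch q q i / qpoch q q (i - n) else 0)"
  proof (cases "n \<le> i")
    case True
    then have "q * q ^ i / q ^ n = q * q ^ (i - n)"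
      using \<open>q \<noteq> 0\<close> by (simp add: power_diff)
    then show ?thesis
      using True nz qpoch_add[of q q "i - n" n] by simp
  next
    case False
    then have "q * q ^ i / q ^ n * q ^ (n - Suc i) = 1"
      using \<open>q \<noteq> 0\<close> by (simp add: field_simps flip: power_add power_Suc)
    then show ?thesis
      using False by (auto simp: qpoch_def intro!: bexI[of _ "n - Suc i"])
  qed
  finally show ?thesis .
qed

lemma sum_triangle_swap:
  fixes f :: "nat \<Rightarrow> nat \<Rightarrow> 'a :: comm_monoid_add"
  shows "(\<Sum>k\<le>m. \<Sum>p\<in>{k..m}. f k p) = (\<Sum>p\<le>m. \<Sum>k\<le>p. f k p)"
  by (simp add: sum.Sigma)
     (rule sum.reindex_bij_witness[of _ prod.swap prod.swap]; auto)

text \<open>This is the passage between the two expansions of the coefficients: on the left \<open>j\<close> occurs only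
  as the exponent of \<open>q^k\<close>, on the right is the sum that arises from the Wall polynomials. Expanding
  \<open>(w q^k;q)_{m-k}\<close> by Rothe's identity leaves, for each power \<open>w^(m-p)\<close>, a \<open>q\<close>-difference of order
  \<open>p\<close> of the monomial of degree \<open>j\<close>; it vanishes for \<open>p > j\<close>, which is where \<open>min m j\<close> comes
  from.\<close>
lemma q_difference_monomial_shifted:
  fixes q w :: "'a :: field"
  assumes "q \<noteq> 0" and nz: "\<And>k. qpoch q q k \<noteq> 0"
  shows "(\<Sum>k\<le>m. qpoch (q powi (- int m)) q k * q ^ k / qpoch q q k
          * qpoch (w * q ^ k) q (m - k) * (q ^ k) ^ j)
     = (\<Sum>p\<le>min m j. rothe_coeff q m (m - p) * w ^ (m - p) * qpoch q q j / qpoch q q (j - p))"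
proof -
  let ?A = "\<lambda>n k. qpoch (q powi (- int n)) q k * q ^ k / qpoch q q k * (q ^ k) ^ j"
  have coeff: "?A m k * (rothe_coeff q (m - k) (m - p) * (w * q ^ k) ^ (m - p))
      = rothe_coeff q m (m - p) * w ^ (m - p) * ?A p k" if "k \<le> p" "p \<le> m" for k p
  proof -
    obtain r where p: "p = k + r" using \<open>k \<le> p\<close> by (metis le_Suc_ex)
    obtain t where m: "m = p + t" using \<open>p \<le> m\<close> by (metis le_Suc_ex)
    have d: "m - k - (m - p) = r" "p - k = r" "m - k = r + t" "m - p = t" "m - t = p"
      using p m by auto
    have "q ^ (m * k) = q ^ (p * k) * q ^ (k * t)"
      by (simp add: m power_add algebra_simps)
    then show ?thesis
      using that nz \<open>q \<noteq> 0\<close>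
      by (simp add: qpoch_inverse_power rothe_coeff_def d power_mult_distrib
          flip: power_mult) (simp add: field_simps)
  qed
  have "(\<Sum>k\<le>m. qpoch (q powi (- int m)) q k * q ^ k / qpoch q q k
          * qpoch (w * q ^ k) q (m - k) * (q ^ k) ^ j)
      = (\<Sum>k\<le>m. \<Sum>p\<in>{k..m}. rothe_coeff q m (m - p) * w ^ (m - p) * ?A p k)"
  proof (intro sum.cong refl)
    fix k assume k: "k \<in> {..m}"
    have "qpoch (w * q ^ k) q (m - k)
        = (\<Sum>p\<in>{k..m}. rothe_coeff q (m - k) (m - p) * (w * q ^ k) ^ (m - p))"
      unfolding rothe_identity[OF nz, symmetric]
      by (rule sum.reindex_bij_witness[of _ "\<lambda>p. m - p" "\<lambda>l. m - l"]) (use k in auto)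
    then have "qpoch (q powi (- int m)) q k * q ^ k / qpoch q q k
          * qpoch (w * q ^ k) q (m - k) * (q ^ k) ^ j
        = (\<Sum>p\<in>{k..m}. ?A m k * (rothe_coeff q (m - k) (m - p) * (w * q ^ k) ^ (m - p)))"
      by (simp only: sum_distrib_left[symmetric]) (simp add: mult_ac)
    also have "\<dots> = (\<Sum>p\<in>{k..m}. rothe_coeff q m (m - p) * w ^ (m - p) * ?A p k)"
      by (intro sum.cong refl coeff) auto
    finally show "qpoch (q powi (- int m)) q k * q ^ k / qpoch q q k
          * qpoch (w * q ^ k) q (m - k) * (q ^ k) ^ j = \<dots>" .
  qed
  also have "\<dots> = (\<Sum>p\<le>m. \<Sum>k\<le>p. rothe_coeff q m (m - p) * w ^ (m - p) * ?A p k)"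
    by (rule sum_triangle_swap)
  also have "\<dots> = (\<Sum>p\<le>m. rothe_coeff q m (m - p) * w ^ (m - p) * 
       (if p \<le> j then qpoch q q j / qpoch q q (j - p) else 0))"
    unfolding sum_distrib_left[symmetric] q_difference_monomial[OF assms] ..
  also have "\<dots> = (\<Sum>p\<le>min m j. rothe_coeff q m (m - p) * w ^ (m - p) * qpoch q q j / qpoch q q (j - p))"
    by (intro sum.mono_neutral_cong_right) auto
  finally show ?thesis .
qed

section \<open>Infinite \<open>q\<close>-Pochhammer symbols and Euler's identity\<close>

lemma mult_power_less_1:
  fixes x q :: real
  assumes "0 < q" "q < 1" "x < 1"
  shows "x * q ^ k < 1"
proof (cases "x \<le> 0")
  case True
  then have "x * q ^ k \<le> 0" using assms by (intro mult_nonpos_nonneg) auto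
  then show ?thesis by simp
next
  case False
  then have "x * q ^ k \<le> x * 1" using assms by (intro mult_left_mono power_le_one) auto
  then show ?thesis using assms by simp
qed

lemma qpoch_pos:
  fixes x q :: real
  assumes "0 < q" "q < 1" "x < 1"
  shows "qpoch x q n > 0"
  using mult_power_less_1[OF assms] by (auto simp: qpoch_def intro!: prod_pos)

lemma convergent_prod_qpoch:
  fixes x q :: "'a :: {real_normed_field, banach}"
  assumes "norm q < 1"
  shows "convergent_prod (\<lambda>k. 1 - x * q ^ k)"
proof -
  have "summable (\<lambda>k. norm (- x * q ^ k))"
    using assms by (auto simp: norm_mult norm_power intro!: summable_mult summable_geometric)
  then have "summable (\<lambda>k. norm ((1 - x * q ^ k) - 1))"
    by simp
  then show ?thesis
    by (intro abs_convergent_prod_imp_convergent_prod) (simp add: abs_convergent_prod_conv_summable)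
qed

lemma qpoch_LIMSEQ:
  fixes x q :: "'a :: {real_normed_field, banach}"
  assumes "norm q < 1"
  shows "(\<lambda>n. qpoch x q n) \<longlonglongrightarrow> qpoch_inf x q"
  using convergent_prod_LIMSEQ[OF convergent_prod_qpoch[OF assms, of x]]
  by - (rule LIMSEQ_imp_Suc, simp add: qpoch_def qpoch_inf_def lessThan_Suc_atMost)

lemma qpoch_inf_nonzero:
  fixes x q :: "'a :: {real_normed_field, banach}"
  assumes "norm q < 1" "norm x < 1"
  shows "qpoch_inf x q \<noteq> 0"
proof -
  have "1 - x * q ^ k \<noteq> 0" for k
    using qpoch_nonzero[OF assms(2,1), of "Suc k"] by (auto simp: qpoch_Suc)
  then show ?thesis
    unfolding qpoch_inf_def
    using prodinf_nonzero[OF convergent_prod_qpoch[OF assms(1)]] by blast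
qed

lemma qpoch_inf_shift:
  fixes x q :: "'a :: {real_normed_field, banach}"
  assumes "norm q < 1"
  shows "qpoch x q n * qpoch_inf (x * q ^ n) q = qpoch_inf x q"
proof (rule LIMSEQ_unique)
  show "(\<lambda>k. qpoch x q n * qpoch (x * q ^ n) q k) \<longlonglongrightarrow> qpoch x q n * qpoch_inf (x * q ^ n) q"
    by (intro tendsto_intros qpoch_LIMSEQ assms)
  show "(\<lambda>k. qpoch x q n * qpoch (x * q ^ n) q k) \<longlonglongrightarrow> qpoch_inf x q"
    using LIMSEQ_ignore_initial_segment[OF qpoch_LIMSEQ[OF assms, of x], of n]
    by (simp only: add.commute[of _ n] qpoch_add)
qed

lemma summable_q_exp:
  fixes x q :: "'a :: {real_normed_field, banach}"
  assumes "norm q < 1" "norm x < 1"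
  shows "summable (\<lambda>k. norm (x ^ k / qpoch q q k))"
proof -
  \<comment> \<open>The ratios tend to \<open>norm x\<close>; any bound strictly between \<open>norm x\<close> and 1 serves.\<close>
  define c where "c = (1 + norm x) / 2"
  have c: "norm x < c" "c < 1" using assms by (simp_all add: c_def)
  have "(\<lambda>k. norm x / norm (1 - q * q ^ k)) \<longlonglongrightarrow> norm x / norm (1 - q * 0)"
    by (intro tendsto_intros LIMSEQ_power_zero assms) simp
  then have "eventually (\<lambda>k. norm x / norm (1 - q * q ^ k) < c) sequentially"
    using c by (intro order_tendstoD) auto
  then obtain N where N: "\<And>k. k \<ge> N \<Longrightarrow> norm x / norm (1 - q * q ^ k) < c"
    by (auto simp: eventually_sequentially)
  show ?thesis
  proof (rule summable_ratio_test[OF \<open>c < 1\<close>, of N])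
    fix k assume "k \<ge> N"
    have "norm (norm (x ^ Suc k / qpoch q q (Suc k)))
        = norm x / norm (1 - q * q ^ k) * norm (norm (x ^ k / qpoch q q k))"
      by (simp add: qpoch_Suc norm_mult norm_divide norm_power mult_ac)
    also have "\<dots> \<le> c * norm (norm (x ^ k / qpoch q q k))"
      using N[OF \<open>k \<ge> N\<close>] by (intro mult_right_mono) auto
    finally show "norm (norm (x ^ Suc k / qpoch q q (Suc k))) \<le> \<dots>" .
  qed
qed

text \<open>The sum \<open>f(x)\<close> of the series satisfies \<open>f(x) - f(qx) = x f(x)\<close>, hence
  \<open>f(x q^n) = (x;q)_n f(x)\<close>; let \<open>n\<close> tend to infinity and use that \<open>f\<close> is continuous at \<open>0\<close>.\<close>
theorem euler_q_exp:
  fixes x q :: "'a :: {real_normed_field, banach}"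
  assumes q: "norm q < 1" and x: "norm x < 1"
  shows "(\<lambda>k. x ^ k / qpoch q q k) sums (1 / qpoch_inf x q)"
proof -
  define f where "f y = (\<Sum>k. 1 / qpoch q q k * y ^ k)" for y
  have sm: "(\<lambda>k. 1 / qpoch q q k * y ^ k) sums f y" if "norm y < 1" for y
    using summable_norm_cancel[OF summable_q_exp[OF q that]]
    by (simp add: f_def summable_sums)
  have nz: "qpoch q q k \<noteq> 0" for k using q by (rule qpoch_nonzero[OF _ q])
  note le = norm_mult_power_less_1[OF _ q]
  have step: "f (y * q) = (1 - y) * f y" if y: "norm y < 1" for y
  proof -
    have "(\<lambda>k. 1 / qpoch q q k * y ^ k - 1 / qpoch q q k * (y * q) ^ k) sums (f y - f (y * q))"
      using y le[OF y, of 1] by (intro sums_diff sm) auto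
    then have "(\<lambda>k. 1 / qpoch q q k * y ^ k * (1 - q ^ k)) sums (f y - f (y * q))"
      by (simp add: algebra_simps diff_divide_distrib power_mult_distrib)
    then have "(\<lambda>k. 1 / qpoch q q (Suc k) * y ^ Suc k * (1 - q ^ Suc k)) sums (f y - f (y * q))"
      by (subst sums_Suc_iff) simp
    moreover have "1 / qpoch q q (Suc k) * y ^ Suc k * (1 - q ^ Suc k) = y * (1 / qpoch q q k * y ^ k)" for k
      using nz[of "Suc k"] by (simp add: qpoch_Suc)
    ultimately have "(\<lambda>k. y * (1 / qpoch q q k * y ^ k)) sums (f y - f (y * q))"
      by simp
    then have "f y - f (y * q) = y * f y"
      using sums_mult[OF sm[OF y], of y] sums_unique2 by blast
    then show ?thesis by (simp add: algebra_simps)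
  qed
  have iter: "f (x * q ^ n) = qpoch x q n * f x" for n
    by (induction n)
       (use step[OF le[OF x]] in \<open>simp_all add: qpoch_Suc mult_ac\<close>)
  have "isCont f 0"
    unfolding f_def
    by (rule isCont_powser[of _ "1/2"]) (use sm[of "1/2"] in \<open>auto simp: sums_iff\<close>)
  moreover have "(\<lambda>n. x * q ^ n) \<longlonglongrightarrow> 0"
    using tendsto_mult[OF tendsto_const LIMSEQ_power_zero[OF q], of x] by simp
  ultimately have "(\<lambda>n. f (x * q ^ n)) \<longlonglongrightarrow> f 0"
    by (rule isCont_tendsto_compose)
  moreover have "f 0 = 1"
    unfolding f_def by (subst powser_zero) simp
  ultimately have "(\<lambda>n. qpoch x q n * f x) \<longlonglongrightarrow> 1"
    by (simp add: iter)
  moreover have "(\<lambda>n. qpoch x q n * f x) \<longlonglongrightarrow> qpoch_inf x q * f x"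
    by (intro tendsto_intros qpoch_LIMSEQ q)
  ultimately have "qpoch_inf x q * f x = 1"
    using LIMSEQ_unique by blast
  then have "f x = 1 / qpoch_inf x q"
    using qpoch_inf_nonzero[OF q x] by (simp add: field_simps)
  with sm[OF x] show ?thesis by simp
qed

lemma qpoch_inf_pos:
  fixes x q :: real
  assumes "0 < q" "q < 1" "x < 1"
  shows "qpoch_inf x q > 0"
  unfolding qpoch_inf_def using mult_power_less_1[OF assms] assms
  by (intro less_0_prodinf convergent_prod_qpoch) auto

section \<open>Continuous \<open>q\<close>-Hermite polynomials\<close>

lemma Arccos_of_real_cos:
  assumes "0 \<le> \<theta>" "\<theta> \<le> pi"
  shows "Arccos (of_real (cos \<theta>)) = of_real \<theta>"
  using assms by (subst of_real_arccos[symmetric]) (auto simp: arccos_cos)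

lemma q_hermite_cos:
  assumes "0 \<le> \<theta>" "\<theta> \<le> pi"
  shows "q_hermite n (of_real (cos \<theta>)) q
     = (\<Sum>k\<le>n. qpoch q q n / (qpoch q q k * qpoch q q (n - k)) * (cis \<theta> ^ (n - k) * cis (- \<theta>) ^ k))"
proof -
  have "exp (\<i> * of_int (int n - 2 * int k) * of_real \<theta>)
      = cis \<theta> ^ (n - k) * cis (- \<theta>) ^ k" if "k \<le> n" for k
  proof -
    have "cis \<theta> ^ (n - k) * cis (- \<theta>) ^ k = cis (real_of_int (int n - 2 * int k) * \<theta>)"
      unfolding Complex.DeMoivre cis_mult
      by (rule arg_cong[of _ _ cis]) (use that in \<open>simp add: of_nat_diff algebra_simps\<close>)
    then show ?thesis
      by (simp add: cis_conv_exp mult_ac)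
  qed
  then show ?thesis
    by (simp add: q_hermite_def Arccos_of_real_cos[OF assms])
qed

text \<open>The Cauchy product of Euler's series at \<open>t e^{i\<theta>}\<close> and \<open>t e^{-i\<theta>}\<close>: its convolution sums are
  the defining sums of the polynomials.\<close>
theorem q_hermite_generating_function:
  fixes q t :: complex
  assumes q: "norm q < 1" and t: "norm t < 1" and \<theta>: "0 \<le> \<theta>" "\<theta> \<le> pi"
  shows "(\<lambda>n. t ^ n / qpoch q q n * q_hermite n (of_real (cos \<theta>)) q)
    sums (1 / (qpoch_inf (t * cis \<theta>) q * qpoch_inf (t * cis (- \<theta>)) q))"
proof -
  have n: "norm (t * cis \<theta>) < 1" "norm (t * cis (- \<theta>)) < 1"
    using t by (simp_all add: norm_mult)
  have nz: "qpoch q q k \<noteq> 0" for k using q by (rule qpoch_nonzero[OF _ q])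
  let ?e = "\<lambda>x k. x ^ k / qpoch q q k"
  have "(\<lambda>n. \<Sum>k\<le>n. ?e (t * cis (- \<theta>)) k * ?e (t * cis \<theta>) (n - k))
      sums ((\<Sum>k. ?e (t * cis (- \<theta>)) k) * (\<Sum>k. ?e (t * cis \<theta>) k))"
    by (intro Cauchy_product_sums summable_q_exp q n)
  also have "(\<Sum>k. ?e (t * cis (- \<theta>)) k) * (\<Sum>k. ?e (t * cis \<theta>) k)
      = 1 / (qpoch_inf (t * cis \<theta>) q * qpoch_inf (t * cis (- \<theta>)) q)"
    using euler_q_exp[OF q n(1)] euler_q_exp[OF q n(2)] by (simp add: sums_iff)
  also have "(\<lambda>n. \<Sum>k\<le>n. ?e (t * cis (- \<theta>)) k * ?e (t * cis \<theta>) (n - k))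
      = (\<lambda>n. t ^ n / qpoch q q n * q_hermite n (of_real (cos \<theta>)) q)"
  proof
    fix n
    have "?e (t * cis (- \<theta>)) k * ?e (t * cis \<theta>) (n - k) = t ^ n / qpoch q q n *
        (qpoch q q n / (qpoch q q k * qpoch q q (n - k)) * (cis \<theta> ^ (n - k) * cis (- \<theta>) ^ k))"
      if "k \<le> n" for k
    proof -
      have "t ^ n = t ^ k * t ^ (n - k)" using that by (simp flip: power_add)
      then show ?thesis using nz by (simp add: power_mult_distrib)
    qed
    then show "(\<Sum>k\<le>n. ?e (t * cis (- \<theta>)) k * ?e (t * cis \<theta>) (n - k))
        = t ^ n / qpoch q q n * q_hermite n (of_real (cos \<theta>)) q"
      unfolding q_hermite_cos[OF \<theta>] sum_distrib_left by (intro sum.cong) auto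
  qed
  finally show ?thesis .
qed

section \<open>Al-Salam--Chihara polynomials\<close>

lemma phi32_terminating:
  fixes q :: "'a :: real_normed_field"
  assumes "q \<noteq> 0"
  shows "phi32 (q powi (- int m)) b c d e q x =
     (\<Sum>k\<le>m. qpoch (q powi (- int m)) q k * qpoch b q k * qpoch c q k /
            (qpoch d q k * qpoch e q k * qpoch q q k) * x ^ k)"
  unfolding phi32_def
  by (rule suminf_finite) (use assms in \<open>auto simp: qpoch_inverse_power_eq_0\<close>)

text \<open>Up to a normalisation these are the coefficients of the coherent state. The name is due to
  \<open>asc_generating_function\<close>: they expand an Al-Salam--Chihara polynomial, divided by infinite
  products, in continuous \<open>q\<close>-Hermite polynomials.\<close>
definition asc_coeff :: "'a :: field \<Rightarrow> nat \<Rightarrow> 'a \<Rightarrow> 'a \<Rightarrow> nat \<Rightarrow> 'a" where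
  "asc_coeff q m a b j =
     (\<Sum>p\<le>min m j. rothe_coeff q m (m - p) * b ^ (m - p) * a ^ (j - p) / qpoch q q (j - p))"

text \<open>At \<open>b = 0\<close> only the summand \<open>p = m\<close> is left.\<close>
lemma asc_coeff_b_0:
  assumes "\<And>k. qpoch q q k \<noteq> 0"
  shows "asc_coeff q m a 0 j = (if m \<le> j then a ^ (j - m) / qpoch q q (j - m) else 0)"
proof (cases "m \<le> j")
  case True
  have "asc_coeff q m a 0 j
      = (\<Sum>p\<in>{m}. rothe_coeff q m (m - p) * 0 ^ (m - p) * a ^ (j - p) / qpoch q q (j - p))"
    unfolding asc_coeff_def using True by (intro sum.mono_neutral_right) auto
  then show ?thesis
    using True assms by (simp add: rothe_coeff_0)
next
  case False
  then show ?thesis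
    by (auto simp: asc_coeff_def intro!: sum.neutral)
qed

text \<open>The mixed generating function behind the wave function. By \<open>q_difference_monomial_shifted\<close> with
  \<open>w = ab\<close>, each term is a combination of \<open>m + 1\<close> terms of the \<open>q\<close>-Hermite generating
  function at the points \<open>a q^k\<close>, \<open>k \<le> m\<close>, so that only finitely many convergent series have to be
  added.\<close>
theorem asc_generating_function:
  fixes q a b :: complex
  assumes q: "q \<noteq> 0" "norm q < 1" and a: "a \<noteq> 0" "norm a < 1" and ab: "qpoch (a * b) q m \<noteq> 0"
    and \<theta>: "0 \<le> \<theta>" "\<theta> \<le> pi"
  shows "(\<lambda>j. asc_coeff q m a b j * q_hermite j (of_real (cos \<theta>)) q)
    sums (asc_formula m (of_real (cos \<theta>)) a b q
      / (qpoch_inf (a * cis \<theta>) q * qpoch_inf (a * cis (- \<theta>)) q))"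
proof -
  let ?H = "\<lambda>j. q_hermite j (of_real (cos \<theta>)) q"
  let ?C = "\<lambda>k. qpoch (q powi (- int m)) q k * q ^ k / qpoch q q k * qpoch (a * b * q ^ k) q (m - k)"
  let ?G = "\<lambda>t. 1 / (qpoch_inf (t * cis \<theta>) q * qpoch_inf (t * cis (- \<theta>)) q)"
  have nz: "qpoch q q k \<noteq> 0" for k using q(2) by (rule qpoch_nonzero[OF _ q(2)])
  note aq = norm_mult_power_less_1[OF a(2) q(2)]
  have G: "?G (a * q ^ k) = qpoch (a * cis \<theta>) q k * qpoch (a * cis (- \<theta>)) q k * ?G a" for k
  proof -
    have n: "norm (a * cis \<theta>) < 1" "norm (a * cis (- \<theta>)) < 1"
      using a by (simp_all add: norm_mult)
    have e: "a * q ^ k * cis \<theta> = a * cis \<theta> * q ^ k" "a * q ^ k * cis (- \<theta>) = a * cis (- \<theta>) * q ^ k"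
      by (simp_all add: mult_ac)
    show ?thesis
      unfolding e qpoch_inf_shift[OF q(2), of "a * cis \<theta>" k, symmetric]
        qpoch_inf_shift[OF q(2), of "a * cis (-\<theta>)" k, symmetric]
      using qpoch_nonzero[OF n(1) q(2), of k] qpoch_nonzero[OF n(2) q(2), of k]
      by simp
  qed
  have "(\<lambda>j. \<Sum>k\<le>m. 1 / a ^ m * ?C k * ((a * q ^ k) ^ j / qpoch q q j * ?H j))
      sums (\<Sum>k\<le>m. 1 / a ^ m * ?C k * ?G (a * q ^ k))"
    by (intro sums_sum sums_mult q_hermite_generating_function q \<theta> aq)
  also have "(\<Sum>k\<le>m. 1 / a ^ m * ?C k * ?G (a * q ^ k)) = asc_formula m (of_real (cos \<theta>)) a b q * ?G a"
  proof -
    have "qpoch (a * b) q k \<noteq> 0 \<and> qpoch (a * b * q ^ k) q (m - k) = qpoch (a * b) q m / qpoch (a * b) q k"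
      if "k \<le> m" for k
      using ab qpoch_add[of "a * b" q k "m - k"] that by auto
    then have "1 / a ^ m * ?C k * ?G (a * q ^ k) = qpoch (a * b) q m / a ^ m *
        (qpoch (q powi (- int m)) q k * qpoch (a * cis \<theta>) q k * qpoch (a * cis (- \<theta>)) q k /
            (qpoch (a * b) q k * qpoch 0 q k * qpoch q q k) * q ^ k) * ?G a" if "k \<le> m" for k
      unfolding G using that by (simp add: mult_ac)
    then show ?thesis
      unfolding asc_formula_def phi32_terminating[OF q(1)] Arccos_of_real_cos[OF \<theta>]
        sum_distrib_left sum_distrib_right
      by (intro sum.cong) (auto simp: cis_conv_exp)
  qed
  also have "(\<lambda>j. \<Sum>k\<le>m. 1 / a ^ m * ?C k * ((a * q ^ k) ^ j / qpoch q q j * ?H j))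
      = (\<lambda>j. asc_coeff q m a b j * ?H j)"
  proof
    fix j
    have "(\<Sum>k\<le>m. 1 / a ^ m * ?C k * ((a * q ^ k) ^ j / qpoch q q j * ?H j))
        = a ^ j / a ^ m / qpoch q q j * ?H j * (\<Sum>k\<le>m. ?C k * (q ^ k) ^ j)"
      by (simp add: sum_distrib_left power_mult_distrib mult_ac)
    also have "(\<Sum>k\<le>m. ?C k * (q ^ k) ^ j)
        = (\<Sum>p\<le>min m j. rothe_coeff q m (m - p) * (a * b) ^ (m - p) * qpoch q q j / qpoch q q (j - p))"
      by (rule q_difference_monomial_shifted[OF q(1) nz])
    also have "a ^ j / a ^ m / qpoch q q j * ?H j * \<dots>
        = asc_coeff q m a b j * ?H j"
      unfolding asc_coeff_def sum_distrib_left sum_distrib_right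
    proof (intro sum.cong refl)
      fix p assume p: "p \<in> {..min m j}"
      then have "j + (m - p) = m + (j - p)"
        by auto
      then have "a ^ j * a ^ (m - p) = a ^ m * a ^ (j - p)"
        by (simp only: power_add[symmetric])
      then show "a ^ j / a ^ m / qpoch q q j * ?H j *
            (rothe_coeff q m (m - p) * (a * b) ^ (m - p) * qpoch q q j / qpoch q q (j - p))
          = rothe_coeff q m (m - p) * b ^ (m - p) * a ^ (j - p) / qpoch q q (j - p) * ?H j"
        using nz[of j] nz[of "j - p"] a by (simp add: power_mult_distrib field_simps)
    qed
    finally show "(\<Sum>k\<le>m. 1 / a ^ m * ?C k * ((a * q ^ k) ^ j / qpoch q q j * ?H j))
        = asc_coeff q m a b j * ?H j" .
  qed
  finally show ?thesis by simp
qed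

text \<open>At \<open>b = 0\<close>, \<open>asc_generating_function\<close> says that the power series
  \<open>g n a = \<Sum>i. H_{i+n} a^i / (q;q)_i\<close> equals \<open>g 0 a\<close> times the Al-Salam--Chihara formula of
  degree \<open>n\<close>. The limit of \<open>g m / g 0\<close> is then read off from the constant terms.\<close>
lemma asc_formula_tendsto_0:
  fixes q :: complex
  assumes q: "q \<noteq> 0" "norm q < 1" and \<theta>: "0 \<le> \<theta>" "\<theta> \<le> pi"
  shows "((\<lambda>a. asc_formula m (of_real (cos \<theta>)) a 0 q) \<longlongrightarrow> q_hermite m (of_real (cos \<theta>)) q) (at 0)"
proof -
  let ?H = "\<lambda>j. q_hermite j (of_real (cos \<theta>)) q"
  let ?G = "\<lambda>t. 1 / (qpoch_inf (t * cis \<theta>) q * qpoch_inf (t * cis (- \<theta>)) q)"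
  define g where "g n a = (\<Sum>i. ?H (i + n) / qpoch q q i * a ^ i)" for n a
  have nz: "qpoch q q k \<noteq> 0" for k using q(2) by (rule qpoch_nonzero[OF _ q(2)])
  have sums: "(\<lambda>i. ?H (i + n) / qpoch q q i * a ^ i) sums (asc_formula n (of_real (cos \<theta>)) a 0 q * ?G a)"
    if a: "a \<noteq> 0" "norm a < 1" for a n
  proof -
    have "(\<lambda>j. asc_coeff q n a 0 j * ?H j) sums (asc_formula n (of_real (cos \<theta>)) a 0 q * ?G a)"
      (is "?f sums _")
      using asc_generating_function[OF q a _ \<theta>, of 0 n] by simp
    moreover have "?f j = 0" if "j < n" for j
      using that by (simp add: asc_coeff_b_0 nz)
    moreover have "?f (i + n) = ?H (i + n) / qpoch q q i * a ^ i" for i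
      by (simp add: asc_coeff_b_0 nz)
    ultimately show ?thesis
      by (subst (asm) sums_zero_iff_shift[of n, symmetric]) auto
  qed
  have cont: "(g n \<longlongrightarrow> ?H n) (at 0)" for n
  proof -
    have "isCont (g n) 0"
      unfolding g_def
      by (rule isCont_powser[of _ "1/2"]) (use sums[of "1/2" n] in \<open>auto simp: sums_iff\<close>)
    moreover have "g n 0 = ?H n"
      unfolding g_def by (subst powser_zero) simp
    ultimately show ?thesis by (simp add: isCont_def)
  qed
  \<comment> \<open>In particular \<open>g 0\<close> tends to 1, so it can be a denominator.\<close>
  have H0: "?H 0 = 1" by (simp add: q_hermite_def)
  have "((\<lambda>a. g m a / g 0 a) \<longlongrightarrow> ?H m / ?H 0) (at 0)"
    by (intro tendsto_divide cont) (simp add: H0)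
  moreover have "eventually (\<lambda>a. g m a / g 0 a = asc_formula m (of_real (cos \<theta>)) a 0 q) (at 0)"
    unfolding eventually_at
  proof (intro exI[of _ 1] conjI ballI impI)
    fix a :: complex assume "a \<noteq> 0 \<and> dist a 0 < 1"
    then have a: "a \<noteq> 0" "norm a < 1" by auto
    have "?G a \<noteq> 0"
      using a q by (simp add: qpoch_inf_nonzero norm_mult)
    moreover have "g n a = asc_formula n (of_real (cos \<theta>)) a 0 q * ?G a" for n
      using sums[OF a, of n] by (simp add: g_def sums_iff)
    moreover have "asc_formula 0 (of_real (cos \<theta>)) a 0 q = 1"
      by (simp add: asc_formula_def phi32_terminating[OF q(1), of 0, simplified])
    ultimately show "g m a / g 0 a = asc_formula m (of_real (cos \<theta>)) a 0 q" by simp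
  qed simp
  ultimately show ?thesis
    using H0 by (simp add: tendsto_cong)
qed

section \<open>The coefficients of the coherent state\<close>

text \<open>The finite sum in reversed order, \<open>p = n - k\<close>. In this order the index has the same meaning for
  \<open>j < m\<close> and for \<open>j \<ge> m\<close> when \<open>n = min m j\<close>.\<close>
lemma wall_poly_expand:
  fixes q :: real
  assumes q: "0 < q" "q < 1"
  shows "wall_poly n X (q ^ d) q
     = (\<Sum>p\<le>n. rothe_coeff q n (n - p) * qpoch q q d / qpoch q q (n - p + d)
          * (q * X / q ^ n) ^ (n - p))"
proof -
  have nz: "qpoch q q k \<noteq> 0" for k using q by (intro qpoch_nonzero) auto
  have "wall_poly n X (q ^ d) q = (\<Sum>k\<le>n. qpoch (q powi (- int n)) q k * qpoch 0 q k
      / (qpoch (q ^ d * q) q k * qpoch q q k) * (q * X) ^ k)"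
    unfolding wall_poly_def phi21_def
    by (rule suminf_finite) (use q in \<open>auto simp: qpoch_inverse_power_eq_0\<close>)
  also have "\<dots> = (\<Sum>k\<le>n. rothe_coeff q n k * qpoch q q d / qpoch q q (k + d) * (q * X / q ^ n) ^ k)"
  proof (intro sum.cong refl)
    fix k assume "k \<in> {..n}"
    moreover have "qpoch q q (k + d) = qpoch q q d * qpoch (q ^ d * q) q k"
      using qpoch_add[of q q d k] by (simp add: add.commute mult.commute)
    ultimately show "qpoch (q powi (- int n)) q k * qpoch 0 q k
        / (qpoch (q ^ d * q) q k * qpoch q q k) * (q * X) ^ k
      = rothe_coeff q n k * qpoch q q d / qpoch q q (k + d) * (q * X / q ^ n) ^ k"
      using q nz by (simp add: qpoch_inverse_power rothe_coeff_def power_divide mult_ac flip: power_mult)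
  qed
  also have "\<dots> = (\<Sum>p\<le>n. rothe_coeff q n (n - p) * qpoch q q d / qpoch q q (n - p + d)
          * (q * X / q ^ n) ^ (n - p))"
    by (rule sum.reindex_bij_witness[of _ "\<lambda>p. n - p" "\<lambda>l. n - l"]) auto
  finally show ?thesis .
qed

lemma cmod_power_cis_Arg:
  "of_real (cmod z) ^ d * cis (real d * Arg z) = z ^ d"
  "of_real (cmod z) ^ d * cis (- (real d * Arg z)) = cnj z ^ d"
proof -
  show *: "of_real (cmod z) ^ d * cis (real d * Arg z) = z ^ d"
    using arg_cong[OF rcis_cmod_Arg[of z], of "\<lambda>w. w ^ d"]
    by (simp only: rcis_def power_mult_distrib Complex.DeMoivre)
  show "of_real (cmod z) ^ d * cis (- (real d * Arg z)) = cnj z ^ d"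
    using arg_cong[OF *, of cnj] by (simp add: cis_cnj)
qed

text \<open>With \<open>s = sqrt q\<close> this makes all powers of \<open>q\<close> in the coefficients, including those under square
  roots, integral powers of \<open>s\<close>.\<close>
lemma power_choose_two_sqrt:
  "(s :: 'a :: comm_monoid_mult) ^ n * (s\<^sup>2) ^ (n choose 2) = s ^ (n * n)"
  by (induction n)
     (simp_all add: power_choose_two_Suc power_add power2_eq_square power_mult_distrib mult_ac
        binomial_eq_0)

lemma rothe_coeff_of_real:
  "rothe_coeff (of_real q) n l = (of_real (rothe_coeff q n l) :: 'a :: real_normed_field)"
  by (simp add: rothe_coeff_def qpoch_of_real)

text \<open>For \<open>m \<le> j\<close> the conjugated coefficient is a real multiple of \<open>cnj z ^ (j - m)\<close>, for \<open>j < m\<close>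
  of \<open>z ^ (m - j)\<close>; these are just the powers that are left of \<open>b^(m-p) a^(j-p)\<close> when it is divided by the largest possible
  power of \<open>z \<cdot> cnj z\<close>. What remains in each case is an identity between real numbers, of which
  the part independent of \<open>p\<close> is stated separately for the prefactor \<open>A\<close>.\<close>
lemma cnj_coeff_h:
  fixes q :: real and z :: complex and m j :: nat
  assumes q: "0 < q" "q < 1"
  defines "c \<equiv> complex_of_real (sqrt ((1 - q) / q ^ m))" and "Q \<equiv> complex_of_real q"
  shows "cnj (coeff_h m q j z) = of_real ((-1) ^ m * sqrt (qpoch q q j) / sqrt (q ^ m * qpoch q q m))
    * asc_coeff Q m (c * cnj z) (c * Q * z) j"
proof -
  define s where "s = sqrt q"
  have s: "s > 0" "q = s\<^sup>2" using q by (simp_all add: s_def)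
  have sq: "sqrt (q ^ k) = s ^ k" for k by (simp add: s_def real_sqrt_power)
  have ch: "q ^ (k choose 2) = s ^ (k * k) / s ^ k" for k
    using power_choose_two_sqrt[of s k] s by (simp add: field_simps)
  have pos: "qpoch q q k > 0" for k
    using q by (intro qpoch_pos)
  then have nz: "qpoch q q k \<noteq> 0" for k by (simp add: less_imp_neq[symmetric])
  have sqj: "qpoch q q k / sqrt (qpoch q q k) = sqrt (qpoch q q k)" for k
    using pos[of k] by (simp add: real_div_sqrt)
  define C where "C = sqrt (1 - q) / s ^ m"
  have c: "c = of_real C"
    by (simp add: c_def C_def real_sqrt_divide sq)
  have C2: "C\<^sup>2 = (1 - q) / q ^ m"
    using q by (simp add: C_def power_divide s flip: power_mult) (simp add: mult.commute)
  define K where "K = (-1) ^ m * sqrt (qpoch q q j) / sqrt (q ^ m * qpoch q q m)"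
  define Y where "Y = (cmod z)\<^sup>2"
  have zz: "z * cnj z = of_real Y"
    unfolding Y_def by (rule complex_norm_square[symmetric])
  have "cnj (coeff_h m q j z) = of_real K * asc_coeff Q m (c * cnj z) (c * Q * z) j"
  proof (cases "m \<le> j")
    case True
    then obtain d where j: "j = m + d" by (metis le_Suc_ex)
    have d: "nat \<bar>int m - int (m + d)\<bar> = d" by simp
    define A where "A = (-1) ^ m * qpoch q q j * q ^ (m choose 2) * sqrt (1 - q) ^ d
      / (qpoch q q d * sqrt (q ^ (m * j) * qpoch q q m * qpoch q q j))"
    have A: "A * qpoch q q d = K * C ^ d"
    proof -
      have pw: "q ^ (m choose 2) / s ^ (m * j) = 1 / (s ^ m * (s ^ m) ^ d)"
        unfolding ch using s by (simp add: j power_add distrib_left flip: power_mult)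
      have "A * qpoch q q d
          = (-1) ^ m * (q ^ (m choose 2) / s ^ (m * j)) * sqrt (1 - q) ^ d
            * (qpoch q q j / sqrt (qpoch q q j)) / sqrt (qpoch q q m)"
        using nz by (simp add: A_def real_sqrt_mult sq mult_ac)
      also have "\<dots> = K * C ^ d"
        unfolding pw sqj K_def C_def by (simp add: real_sqrt_mult sq power_divide mult_ac)
      finally show ?thesis .
    qed
    have "cnj (coeff_h m q j z) = of_real (A * wall_poly m ((1 - q) * Y) (q ^ d) q)
        * (of_real (cmod z) ^ d * cis (- (real d * Arg z)))"
      by (simp add: coeff_h_def j d cis_cnj A_def Y_def)
    also have "\<dots> = (\<Sum>p\<le>m. of_real (A * (rothe_coeff q m (m - p)
            * qpoch q q d / qpoch q q (m - p + d) * (q * ((1 - q) * Y) / q ^ m) ^ (m - p))) * cnj z ^ d)"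
      unfolding cmod_power_cis_Arg wall_poly_expand[OF q] by (simp add: sum_distrib_left sum_distrib_right)
    also have "\<dots> = (\<Sum>p\<le>m. of_real K * (rothe_coeff Q m (m - p)
            * (c * Q * z) ^ (m - p) * (c * cnj z) ^ (j - p) / qpoch Q Q (j - p)))"
    proof (intro sum.cong refl)
      fix p assume "p \<in> {..m}"
      then obtain e where m: "m = p + e" by (metis atMost_iff le_Suc_ex)
      have i: "m - p = e" "j - p = e + d" by (simp_all add: j m)
      have "(c * Q * z) ^ e * (c * cnj z) ^ (e + d) = ((c\<^sup>2 * Q) * (z * cnj z)) ^ e * c ^ d * cnj z ^ d"
        by (simp add: power_add power_mult_distrib power2_eq_square mult_ac)
      also have "\<dots> = of_real ((C\<^sup>2 * q * Y) ^ e * C ^ d) * cnj z ^ d"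
        unfolding zz by (simp add: c Q_def)
      finally have *: "(c * Q * z) ^ e * (c * cnj z) ^ (e + d) = \<dots>" .
      have "of_real K * (rothe_coeff Q m e * (c * Q * z) ^ e * (c * cnj z) ^ (e + d) / qpoch Q Q (e + d))
         = of_real K * (rothe_coeff Q m e * ((c * Q * z) ^ e * (c * cnj z) ^ (e + d)) / qpoch Q Q (e + d))"
        by (simp add: mult_ac)
      also have "\<dots>
          = of_real (K * C ^ d * (rothe_coeff q m e / qpoch q q (e + d) * (C\<^sup>2 * q * Y) ^ e)) * cnj z ^ d"
        unfolding * unfolding Q_def rothe_coeff_of_real qpoch_of_real by (simp add: mult_ac)
      also have "K * C ^ d * (rothe_coeff q m e / qpoch q q (e + d) * (C\<^sup>2 * q * Y) ^ e)
          = A * (rothe_coeff q m e * qpoch q q d / qpoch q q (e + d) * (q * ((1 - q) * Y) / q ^ m) ^ e)"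
        unfolding A[symmetric] C2 by (simp add: mult_ac)
      finally show "of_real (A * (rothe_coeff q m (m - p)
            * qpoch q q d / qpoch q q (m - p + d) * (q * ((1 - q) * Y) / q ^ m) ^ (m - p))) * cnj z ^ d
        = of_real K * (rothe_coeff Q m (m - p)
            * (c * Q * z) ^ (m - p) * (c * cnj z) ^ (j - p) / qpoch Q Q (j - p))"
        unfolding i by simp
    qed
    finally show ?thesis
      using True by (simp add: asc_coeff_def sum_distrib_left)
  next
    case False
    then obtain d where m: "m = j + d" by (metis le_Suc_ex nat_le_linear)
    have d: "nat \<bar>int (j + d) - int j\<bar> = d" by simp
    define A where "A = (-1) ^ j * qpoch q q m * q ^ (j choose 2) * sqrt (1 - q) ^ d
      / (qpoch q q d * sqrt (q ^ (m * j) * qpoch q q m * qpoch q q j))"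
    have A: "A * qpoch q q d * qpoch q q j = K * (-1) ^ d * q ^ (d choose 2) * q ^ d * C ^ d * qpoch q q m"
    proof -
      have sgn: "(-1 :: real) ^ m * (-1) ^ d = (-1) ^ j"
        by (simp add: m power_add mult.assoc flip: power_mult_distrib)
      have pw: "q ^ (j choose 2) / s ^ (m * j) = q ^ (d choose 2) * q ^ d / (s ^ m * (s ^ m) ^ d)"
        unfolding ch using s
        by (simp add: m power_add power2_eq_square power_mult_distrib field_simps flip: power_mult)
      have "A * qpoch q q d * qpoch q q j
          = (-1) ^ j * (q ^ (j choose 2) / s ^ (m * j)) * sqrt (1 - q) ^ d * qpoch q q m
            * (qpoch q q j / sqrt (qpoch q q j)) / sqrt (qpoch q q m)"
        using nz by (simp add: A_def real_sqrt_mult sq mult_ac)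
      also have "\<dots> = K * (-1) ^ d * q ^ (d choose 2) * q ^ d * C ^ d * qpoch q q m"
        unfolding pw sqj K_def C_def sgn[symmetric]
        by (simp add: real_sqrt_mult sq power_divide mult_ac)
      finally show ?thesis .
    qed
    have "cnj (coeff_h m q j z) = of_real (A * wall_poly j ((1 - q) * Y) (q ^ d) q)
        * (of_real (cmod z) ^ d * cis (real d * Arg z))"
      by (simp add: coeff_h_def m d cis_cnj A_def Y_def)
    also have "\<dots> = (\<Sum>p\<le>j. of_real (A * (rothe_coeff q j (j - p)
            * qpoch q q d / qpoch q q (j - p + d) * (q * ((1 - q) * Y) / q ^ j) ^ (j - p))) * z ^ d)"
      unfolding cmod_power_cis_Arg wall_poly_expand[OF q] by (simp add: sum_distrib_left sum_distrib_right)
    also have "\<dots> = (\<Sum>p\<le>j. of_real K * (rothe_coeff Q m (m - p)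
            * (c * Q * z) ^ (m - p) * (c * cnj z) ^ (j - p) / qpoch Q Q (j - p)))"
    proof (intro sum.cong refl)
      fix p assume "p \<in> {..j}"
      then obtain e where j: "j = p + e" by (metis atMost_iff le_Suc_ex)
      have i: "m - p = e + d" "j - p = e" by (simp_all add: j m)
      have "(c * Q * z) ^ (e + d) * (c * cnj z) ^ e = ((c\<^sup>2 * Q) * (z * cnj z)) ^ e * (c * Q) ^ d * z ^ d"
        by (simp add: power_add power_mult_distrib power2_eq_square mult_ac)
      also have "\<dots> = of_real ((C\<^sup>2 * q * Y) ^ e * (C * q) ^ d) * z ^ d"
        unfolding zz by (simp add: c Q_def)
      finally have *: "(c * Q * z) ^ (e + d) * (c * cnj z) ^ e = \<dots>" .
      have "(e + d choose 2) = (e choose 2) + (d choose 2) + e * d"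
        by (induction d) (simp_all add: numeral_2_eq_2)
      then have r: "rothe_coeff q m (e + d) * qpoch q q j * qpoch q q (e + d)
          = (-1) ^ d * q ^ (d choose 2) * q ^ (e * d) * qpoch q q m * qpoch q q e * rothe_coeff q j e"
        using nz by (simp add: rothe_coeff_def m j power_add)
      have "of_real K * (rothe_coeff Q m (e + d) * (c * Q * z) ^ (e + d) * (c * cnj z) ^ e / qpoch Q Q e)
         = of_real K * (rothe_coeff Q m (e + d) * ((c * Q * z) ^ (e + d) * (c * cnj z) ^ e) / qpoch Q Q e)"
        by (simp add: mult_ac)
      also have "\<dots>
          = of_real (K * rothe_coeff q m (e + d) * C ^ d * q ^ d / qpoch q q e * (C\<^sup>2 * q * Y) ^ e) * z ^ d"
        unfolding * unfolding Q_def rothe_coeff_of_real qpoch_of_real by (simp add: mult_ac power_mult_distrib)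
      also have "K * rothe_coeff q m (e + d) * C ^ d * q ^ d / qpoch q q e * (C\<^sup>2 * q * Y) ^ e
          = A * (rothe_coeff q j e * qpoch q q d / qpoch q q (e + d) * (q * ((1 - q) * Y) / q ^ j) ^ e)"
      proof -
        have \<rho>: "rothe_coeff q m (e + d) = (-1) ^ d * q ^ (d choose 2) * q ^ (e * d) * qpoch q q m * qpoch q q e
            * rothe_coeff q j e / (qpoch q q j * qpoch q q (e + d))"
          using r nz by (simp add: field_simps)
        have \<alpha>: "A = K * (-1) ^ d * q ^ (d choose 2) * q ^ d * C ^ d * qpoch q q m / (qpoch q q d * qpoch q q j)"
          using A nz by (simp add: field_simps)
        have "q * ((1 - q) * Y) / q ^ j = q ^ d * (C\<^sup>2 * q * Y)"
          using q unfolding C2 m by (simp add: power_add)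
        then have Y: "(q * ((1 - q) * Y) / q ^ j) ^ e = q ^ (e * d) * (C\<^sup>2 * q * Y) ^ e"
          by (simp add: power_mult_distrib mult.commute[of e] flip: power_mult)
        show ?thesis
          unfolding Y \<rho> \<alpha> using nz by simp
      qed
      finally show "of_real (A * (rothe_coeff q j (j - p)
            * qpoch q q d / qpoch q q (j - p + d) * (q * ((1 - q) * Y) / q ^ j) ^ (j - p))) * z ^ d
        = of_real K * (rothe_coeff Q m (m - p)
            * (c * Q * z) ^ (m - p) * (c * cnj z) ^ (j - p) / qpoch Q Q (j - p))"
        unfolding i by simp
    qed
    finally show ?thesis
      using False by (simp add: asc_coeff_def sum_distrib_left)
  qed
  then show ?thesis by (simp only: K_def)
qed

section \<open>The wave function\<close>

text \<open>To combine the square roots, \<open>norm_factor\<close> has to be positive, as its power with exponent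
  \<open>-1/2\<close> is a real power; its value is
  \<open>q^(-m) (qy;q)_m / (y;q)_\<infinity>\<close> with \<open>y = \<bar>a\<bar>\<^sup>2 < 1\<close>. The bound on \<open>\<xi>\<close> makes \<open>\<theta>\<close> a
  real angle with \<open>cos \<theta>\<close> equal to the argument of the polynomials.\<close>
theorem proposition1p1:
  fixes m :: nat and q :: real and z :: complex and \<xi> :: real
  assumes "0 < q" and "q < 1"
    and "z \<in> domain_C q m"
    and "\<xi> \<in> interval_I q"
  defines "\<theta> \<equiv> arccos (\<xi> * sqrt ((1 - q) / 2))"
    and "c \<equiv> complex_of_real (sqrt ((1 - q) / q ^ m))"
  shows "summable (\<lambda>j. cnj (coeff_h m q j z) * phi_fun q j \<xi>)
    \<and> wave_function m q z \<xi> =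
      (-1) ^ m
      * of_real (sqrt (sqrt 2 * weight q (sqrt 2 * \<xi>)
          / (q ^ m * qpoch q q m * norm_factor m q ((cmod z)\<^sup>2))))
      * (al_salam_chihara m (of_real (sqrt ((1 - q) / 2) * \<xi>))
            (c * cnj z) (c * of_real q * z) (of_real q)
         / (qpoch_inf (c * cnj z * cis \<theta>) (of_real q)
            * qpoch_inf (c * cnj z * cis (- \<theta>)) (of_real q)))"
proof -
  note q = \<open>0 < q\<close> \<open>q < 1\<close>
  define Q where "Q = complex_of_real q"
  define W where "W = sqrt 2 * weight q (sqrt 2 * \<xi>)"
  define N where "N = norm_factor m q ((cmod z)\<^sup>2)"
  define y where "y = (1 - q) * (cmod z)\<^sup>2 / q ^ m"
  define a where "a = c * cnj z"
  define b where "b = c * Q * z"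
  let ?Qm = "al_salam_chihara m (of_real (sqrt ((1 - q) / 2) * \<xi>)) a b Q"
  let ?D = "qpoch_inf (a * cis \<theta>) Q * qpoch_inf (a * cis (- \<theta>)) Q"
  have Q: "Q \<noteq> 0" "norm Q < 1" using q by (simp_all add: Q_def)
  have nzQ: "qpoch Q Q k \<noteq> 0" for k using Q by (intro qpoch_nonzero) auto
  have y: "0 \<le> y" "y < 1"
    using q \<open>z \<in> domain_C q m\<close> by (simp_all add: y_def domain_C_def)
  have N_pos: "N > 0"
  proof -
    have "q powi (- int m) * (1 - q) * (cmod z)\<^sup>2 = y" "q powi (1 - int m) * (1 - q) * (cmod z)\<^sup>2 = q * y"
      using q by (simp_all add: y_def power_int_minus power_int_diff field_simps)
    moreover have "q * y < 1"
      using mult_power_less_1[OF q \<open>y < 1\<close>, of 1] by (simp add: mult.commute)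
    ultimately show ?thesis
      using q y by (simp add: N_def norm_factor_def qpoch_pos qpoch_inf_pos)
  qed
  have x: "sqrt ((1 - q) / 2) * \<xi> = cos \<theta>" and \<theta>: "0 \<le> \<theta>" "\<theta> \<le> pi"
  proof -
    have "\<bar>\<xi>\<bar> < sqrt 2 / sqrt (1 - q)"
      using \<open>\<xi> \<in> interval_I q\<close> by (auto simp: interval_I_def abs_less_iff)
    then have "\<bar>\<xi> * sqrt ((1 - q) / 2)\<bar> \<le> 1"
      using q by (simp add: abs_mult real_sqrt_divide field_simps)
    then show "sqrt ((1 - q) / 2) * \<xi> = cos \<theta>" "0 \<le> \<theta>" "\<theta> \<le> pi"
      by (simp_all add: \<theta>_def arccos_lbound arccos_ubound mult.commute abs_le_iff)
  qed
  have ab: "a * b = of_real (y * q)" and a: "norm a < 1"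
  proof -
    have c2: "c * c = of_real ((1 - q) / q ^ m)"
      using q unfolding c_def by (simp flip: of_real_mult)
    have "a * b = c * c * Q * (z * cnj z)"
      by (simp add: a_def b_def mult_ac)
    also have "\<dots> = of_real (y * q)"
      unfolding c2 Q_def y_def complex_norm_square[symmetric] by simp
    finally show "a * b = of_real (y * q)" .
    have "(norm a)\<^sup>2 = y"
      using q by (simp add: a_def c_def y_def norm_mult power_mult_distrib)
    then show "norm a < 1"
      using y by (metis norm_ge_zero power2_less_imp_less one_power2 zero_le_one)
  qed
  have ab_nz: "qpoch (a * b) Q m \<noteq> 0"
  proof (rule qpoch_nonzero[OF _ Q(2)])
    have "y * q \<le> y * 1" using q y by (intro mult_left_mono) auto
    then show "norm (a * b) < 1" using y q unfolding ab by (simp add: norm_mult)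
  qed
  have asc: "(\<lambda>j. asc_coeff Q m a b j * q_hermite j (of_real (cos \<theta>)) Q) sums (?Qm / ?D)"
  proof (cases "z = 0")
    case False
    then have "a \<noteq> 0" using q by (simp add: a_def c_def)
    \<comment> \<open>As \<open>(ab;q)_m\<close> does not vanish, the polynomial is given by its formula and not by a limit.\<close>
    then show ?thesis
      using asc_generating_function[OF Q _ a ab_nz \<theta>] ab_nz
      by (simp add: al_salam_chihara_def x)
  next
    case True
    then have 0: "a = 0" "b = 0" by (simp_all add: a_def b_def)
    have "?Qm = q_hermite m (of_real (cos \<theta>)) Q"
      using tendsto_Lim[OF _ asc_formula_tendsto_0[OF Q \<theta>]]
      by (simp add: al_salam_chihara_def x 0)
    moreover have "?D = 1" by (simp add: 0 qpoch_inf_def)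
    moreover have "asc_coeff Q m a b j = (if j = m then 1 else 0)" for j
      by (auto simp: 0 asc_coeff_b_0[OF nzQ])
    ultimately show ?thesis
      using sums_single[of m "\<lambda>j. q_hermite j (of_real (cos \<theta>)) Q"]
      by (simp add: if_distrib[of "\<lambda>u. u * _"] cong: if_cong)
  qed
  define B where "B = complex_of_real ((-1) ^ m * sqrt W / sqrt (q ^ m * qpoch q q m))"
  have "cnj (coeff_h m q j z) * phi_fun q j \<xi>
      = B * (asc_coeff Q m a b j * q_hermite j (of_real (cos \<theta>)) Q)" for j
  proof -
    have "sqrt (qpoch q q j) \<noteq> 0" using qpoch_pos[OF q, of q j] q by simp
    then have "B = of_real ((-1) ^ m * sqrt (qpoch q q j) / sqrt (q ^ m * qpoch q q m))
        * of_real (sqrt (W / qpoch q q j))"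
      unfolding B_def of_real_mult[symmetric] by (simp add: real_sqrt_divide)
    then show ?thesis
      unfolding cnj_coeff_h[OF q, of m j z, folded c_def Q_def, folded a_def b_def]
        phi_fun_def W_def[symmetric] x Q_def[symmetric]
      by (simp only: mult_ac)
  qed
  then have sums: "(\<lambda>j. cnj (coeff_h m q j z) * phi_fun q j \<xi>) sums (B * (?Qm / ?D))"
    using sums_mult[OF asc, of B] by simp
  have "N powr (- (1/2)) * ((-1) ^ m * sqrt W / sqrt (q ^ m * qpoch q q m))
      = (-1) ^ m * sqrt (W / (q ^ m * qpoch q q m * N))"
    using N_pos by (simp add: powr_minus powr_half_sqrt real_sqrt_divide real_sqrt_mult field_simps)
  from arg_cong[OF this, of complex_of_real]
  have "of_real (N powr (- (1/2))) * B = (-1) ^ m * of_real (sqrt (W / (q ^ m * qpoch q q m * N)))"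
    by (simp add: B_def)
  then have "wave_function m q z \<xi> = (-1) ^ m * of_real (sqrt (W / (q ^ m * qpoch q q m * N))) * (?Qm / ?D)"
    unfolding wave_function_def N_def[symmetric] using sums by (simp add: sums_iff mult.assoc[symmetric])
  with sums show ?thesis
    unfolding W_def N_def a_def b_def Q_def by (auto simp: sums_iff)
qed

end
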